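(* Let $p\geq 1$, $q\geq 0$ be integers. The lightlike geodesics in $\mathcal H^{p,q}$ are precisely the straight lines spanned by a lightlike vector, i.e. the nonempty intersections with $\{z>0\}$ of the affine lines of $\mathbb R^{p-1}\oplus\mathbb R^q\oplus\mathbb R$ directed by a nonzero vector $(u,v,w)$ with $\|u\|^2-\|v\|^2+w^2=0$. Such geodesics are incomplete at the end where they escape from compact sets of $\mathcal H^{p,q}\cup\partial\mathcal H^{p,q}$, unless they are contained in a horizontal hyperplane $\{z=c\}$, in which case they are complete.
   Context: The half-space model is $\mathcal H^{p,q}=\{(x,y,z)\in\mathbb R^{p-1}\oplus\mathbb R^q\oplus\mathbb R : z>0\}$ with the pseudo-Riemannian metric $g_{p,q}=\frac{dx_1^2+\dots+dx_{p-1}^2-dy_1^2-\dots-dy_q^2+dz^2}{z^2}$; $\partial\mathcal H^{p,q}=\{z=0\}$ is its boundary in $\mathbb R^{p+q}$. $\|\cdot\|$ denotes the Euclidean norm on $\mathbb R^{p-1}$ and on $\mathbb R^q$. Geodesics are maximal, and "geodesic" refers to the image of the parametrized (nonconstant) curve. A geodesic is lightlike if its tangent vector is isotropic for $g_{p,q}$. A geodesic is complete if its affine parameterization is defined on all of $\mathbb R$; it is complete on one side (at one end) if it admits an affine parameterization defined on a half-open interval $[a,+\infty)$ going towards that end, and incomplete at that end otherwise. *)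

theory Defs
  imports "HOL-Analysis.Analysis"
begin

section \<open>Geodesics of a pseudo-Riemannian metric on an open subset of a coordinate space\<close>

text \<open>A metric is given by its Gram matrices \<open>g x\<close> in the standard coordinates of \<open>real^'n\<close>.\<close>

definition partial_deriv :: "'n \<Rightarrow> (real^'n \<Rightarrow> real) \<Rightarrow> real^'n \<Rightarrow> real" where
  "partial_deriv i f x = frechet_derivative f (at x) (axis i 1)"

definition christoffel ::
  "(real^'n \<Rightarrow> real^'n^'n) \<Rightarrow> real^'n \<Rightarrow> 'n \<Rightarrow> 'n \<Rightarrow> 'n \<Rightarrow> real" where
  "christoffel g x m i j =
     (1/2) * (\<Sum>l\<in>UNIV. matrix_inv (g x) $ m $ l *
        (partial_deriv i (\<lambda>y. g y $ j $ l) x + partial_deriv j (\<lambda>y. g y $ i $ l) x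
          - partial_deriv l (\<lambda>y. g y $ i $ j) x))"

text \<open>Nonconstant, affinely parametrized geodesics of \<open>(U, g)\<close>, not necessarily maximal.
  The values of \<open>c\<close> outside the open interval \<open>I\<close> are irrelevant.\<close>

definition geodesic_param ::
  "(real^'n \<Rightarrow> real^'n^'n) \<Rightarrow> (real^'n) set \<Rightarrow> real set \<Rightarrow> (real \<Rightarrow> real^'n) \<Rightarrow> bool" where
  "geodesic_param g U I c \<longleftrightarrow>
     open I \<and> is_interval I \<and> c ` I \<subseteq> U \<and> \<not> c constant_on I \<and>
     (\<exists>v a. \<forall>t\<in>I. (c has_vector_derivative v t) (at t) \<and>
        (v has_vector_derivative a t) (at t) \<and>
        (\<forall>m. a t $ m +
           (\<Sum>i\<in>UNIV. \<Sum>j\<in>UNIV. christoffel g (c t) m i j * v t $ i * v t $ j) = 0))"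

definition maximal_geodesic_param ::
  "(real^'n \<Rightarrow> real^'n^'n) \<Rightarrow> (real^'n) set \<Rightarrow> real set \<Rightarrow> (real \<Rightarrow> real^'n) \<Rightarrow> bool" where
  "maximal_geodesic_param g U I c \<longleftrightarrow>
     geodesic_param g U I c \<and>
     (\<forall>J c'. geodesic_param g U J c' \<and> I \<subseteq> J \<and> (\<forall>t\<in>I. c' t = c t) \<longrightarrow> J = I)"

text \<open>From here on a geodesic is the image \<open>S\<close> of a maximal geodesic parametrization.\<close>

definition lightlike_geodesic ::
  "(real^'n \<Rightarrow> real^'n^'n) \<Rightarrow> (real^'n) set \<Rightarrow> (real^'n) set \<Rightarrow> bool" where
  "lightlike_geodesic g U S \<longleftrightarrow>
     (\<exists>I c. maximal_geodesic_param g U I c \<and> S = c ` I \<and>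
        (\<forall>t\<in>I. vector_derivative c (at t) \<bullet> (g (c t) *v vector_derivative c (at t)) = 0))"

definition complete_geodesic ::
  "(real^'n \<Rightarrow> real^'n^'n) \<Rightarrow> (real^'n) set \<Rightarrow> (real^'n) set \<Rightarrow> bool" where
  "complete_geodesic g U S \<longleftrightarrow> (\<exists>c. maximal_geodesic_param g U UNIV c \<and> S = c ` UNIV)"

text \<open>The end towards which a curve on an interval \<open>I\<close> runs for increasing parameter is the filter
  generated by the tails of the curve. Since \<open>t \<mapsto> c (-t)\<close> parametrizes the same geodesic,
  both ends of a geodesic occur as forward ends of its parametrizations.\<close>

definition forward_end :: "real set \<Rightarrow> (real \<Rightarrow> real^'n) \<Rightarrow> (real^'n) filter" where
  "forward_end I c = (INF s\<in>I. principal (c ` (I \<inter> {s<..})))"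

definition geodesic_ends ::
  "(real^'n \<Rightarrow> real^'n^'n) \<Rightarrow> (real^'n) set \<Rightarrow> (real^'n) set \<Rightarrow> (real^'n) filter set" where
  "geodesic_ends g U S =
     {forward_end I c | I c. maximal_geodesic_param g U I c \<and> S = c ` I}"

text \<open>As geodesic parametrizations live on open intervals, one on \<open>[a, \<infinity>)\<close> is expressed
  by one on an open interval \<open>J\<close> containing \<open>[a, \<infinity>)\<close>.\<close>

definition complete_at_end ::
  "(real^'n \<Rightarrow> real^'n^'n) \<Rightarrow> (real^'n) set \<Rightarrow> (real^'n) set \<Rightarrow> (real^'n) filter \<Rightarrow> bool" where
  "complete_at_end g U S E \<longleftrightarrow>
     (\<exists>J c a. geodesic_param g U J c \<and> {a..} \<subseteq> J \<and> c ` J \<subseteq> S \<and> forward_end J c = E)"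

definition escapes_compacts :: "(real^'n) set \<Rightarrow> (real^'n) filter \<Rightarrow> bool" where
  "escapes_compacts M E \<longleftrightarrow> (\<forall>K. compact K \<and> K \<subseteq> M \<longrightarrow> (\<forall>\<^sub>F x in E. x \<notin> K))"


section \<open>The half-space model\<close>

text \<open>To allow \<open>p = 1\<close> and \<open>q = 0\<close>, the coordinates of \<open>real^'n\<close>, where \<open>CARD('n) = p + q\<close>,
  are partitioned into a set \<open>X\<close> of \<open>p - 1\<close> coordinates, a set \<open>Y\<close> of \<open>q\<close> coordinates, and the
  single coordinate \<open>k\<close> playing the role of \<open>z\<close>.\<close>

definition half_space :: "'n \<Rightarrow> (real^'n) set" where
  "half_space k = {x. x $ k > 0}"

text \<open>The half-space together with its boundary.\<close>

definition closed_half_space :: "'n \<Rightarrow> (real^'n) set" where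
  "closed_half_space k = {x. x $ k \<ge> 0}"

definition half_space_metric :: "'n set \<Rightarrow> 'n \<Rightarrow> real^'n \<Rightarrow> real^'n^'n" where
  "half_space_metric Y k x =
     (\<chi> i j. if i = j then (if i \<in> Y then -1 else 1) / (x $ k)^2 else 0)"

text \<open>\<open>L2_set (\<lambda>i. d $ i) A\<close> is the Euclidean norm of the component of \<open>d\<close> in the
  coordinates \<open>A\<close>.\<close>

definition lightlike_direction :: "'n set \<Rightarrow> 'n set \<Rightarrow> 'n \<Rightarrow> real^'n \<Rightarrow> bool" where
  "lightlike_direction X Y k d \<longleftrightarrow>
     d \<noteq> 0 \<and> (L2_set (\<lambda>i. d $ i) X)^2 - (L2_set (\<lambda>i. d $ i) Y)^2 + (d $ k)^2 = 0"

end

theory Submission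
  imports Defs
begin

text \<open>The half-space metric is conformal to a flat one, \<open>g = \<eta> / z\<^sup>2\<close> with \<open>\<eta>\<close> constant and
  diagonal with entries \<open>1\<close> and \<open>-1\<close>. Its geodesic equation is
  \<open>z \<cdot> c'' = 2 z' c' - \<eta>(c', c') e\<^sub>k\<close>. Hence \<open>\<eta>(c', c') / z\<^sup>2\<close> is constant along a geodesic, so a
  geodesic that is lightlike at one time is lightlike throughout, and then the last term drops
  out. What remains, \<open>z \<cdot> c'' = 2 z' c'\<close>, is solved by two successive first integrals: \<open>c' / z\<^sup>2\<close> is
  a constant vector, whence \<open>1 / z\<close> is an affine function of the time. With \<open>x = c(t\<^sub>0)\<close>,
  \<open>V = c'(t\<^sub>0)\<close> and \<open>h = x\<^sub>k\<close> this forces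
  \<open>c(t\<^sub>0 + s) = x + (s h / (h - s V\<^sub>k)) V\<close>
  on a subset of \<open>{s. s V\<^sub>k < h}\<close> (\<open>null_geodesic_eq_null_curve\<close>). Since the inequality bounds
  every geodesic with this initial velocity, the explicit curve on the full set is maximal, and
  the Moebius change of parameter \<open>s \<mapsto> s h / (h - s V\<^sub>k)\<close> maps that set onto all \<open>r\<close> for which
  \<open>x + r V\<close> lies in the half-space. So the maximal lightlike geodesics trace out exactly the
  lightlike lines cut with the half-space (\<open>lightlike_geodesic_half_space_iff\<close>).

  If \<open>V\<^sub>k = 0\<close>, the parameter set is all of \<open>\<real>\<close>. If \<open>V\<^sub>k \<noteq> 0\<close>, the line has one end at which the
  height tends to infinity and one that converges to a boundary point. Compact subsets of the
  closed half-space can only be escaped at the former (\<open>escaping_imp_rising\<close>), and a curve running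
  towards it has \<open>V\<^sub>k > 0\<close>, so its parameter is bounded above by \<open>t\<^sub>0 + h / V\<^sub>k\<close>: the geodesic is
  incomplete there.\<close>


section \<open>The geodesic equation of the half-space\<close>

definition coord_sign :: "'n set \<Rightarrow> 'n \<Rightarrow> real" where
  "coord_sign Y i = (if i \<in> Y then -1 else 1)"

text \<open>The quadratic form of the flat metric conformal to that of the half-space.\<close>

definition flat_form :: "'n set \<Rightarrow> real^'n::finite \<Rightarrow> real" where
  "flat_form Y v = (\<Sum>i\<in>UNIV. coord_sign Y i * (v $ i)\<^sup>2)"

lemma coord_sign_square [simp]: "coord_sign Y i * coord_sign Y i = 1"
  by (simp add: coord_sign_def)

lemma flat_form_scaleR: "flat_form Y (r *\<^sub>R v) = r\<^sup>2 * flat_form Y v"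
  by (simp add: flat_form_def sum_distrib_left power_mult_distrib mult_ac)

lemma half_space_metric_nth:
  "half_space_metric Y k x $ i $ j = (if i = j then coord_sign Y i / (x $ k)\<^sup>2 else 0)"
  by (simp add: half_space_metric_def coord_sign_def)

lemma half_space_metric_quadratic_form:
  "v \<bullet> (half_space_metric Y k x *v v) = flat_form Y v / (x $ k)\<^sup>2"
proof -
  have "(half_space_metric Y k x *v v) $ i = coord_sign Y i / (x $ k)\<^sup>2 * v $ i" for i
    by (simp add: matrix_vector_mult_def half_space_metric_nth if_distrib[of "\<lambda>u. u * _"] cong: if_cong)
  then show ?thesis
    by (simp add: inner_vec_def flat_form_def sum_divide_distrib power2_eq_square mult_ac)
qed

lemma matrix_inv_eqI:
  fixes A :: "'a::semiring_1^'n^'m"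
  assumes "A ** B = mat 1" "B ** A = mat 1"
  shows "matrix_inv A = B"
proof -
  have "A ** matrix_inv A = mat 1 \<and> matrix_inv A ** A = mat 1"
    unfolding matrix_inv_def by (rule someI[of _ B]) (use assms in simp)
  then show ?thesis
    by (metis assms(2) matrix_mul_assoc matrix_mul_lid matrix_mul_rid)
qed

lemma matrix_inv_half_space_metric:
  assumes "x $ k \<noteq> 0"
  shows "matrix_inv (half_space_metric Y k x) $ m $ l =
           (if m = l then coord_sign Y m * (x $ k)\<^sup>2 else 0)"
proof -
  define B :: "real^'a^'a" where
    "B = (\<chi> m l. if m = l then coord_sign Y m * (x $ k)\<^sup>2 else 0)"
  have "half_space_metric Y k x ** B = mat 1" "B ** half_space_metric Y k x = mat 1"
    using assms
    by (auto simp: vec_eq_iff matrix_matrix_mult_def half_space_metric_nth B_def mat_def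
        if_distrib[of "\<lambda>u. u * _"] if_distrib[of "\<lambda>u. _ * u"] coord_sign_def cong: if_cong)
  then have "matrix_inv (half_space_metric Y k x) = B"
    by (rule matrix_inv_eqI)
  then show ?thesis
    by (simp add: B_def)
qed

lemma partial_deriv_half_space_metric:
  assumes "x $ k \<noteq> 0"
  shows "partial_deriv i (\<lambda>y. half_space_metric Y k y $ j $ l) x =
           (if i = k \<and> j = l then - 2 * coord_sign Y j / (x $ k) ^ 3 else 0)"
proof (cases "j = l")
  case True
  have "((\<lambda>y. coord_sign Y j / (y $ k)\<^sup>2) has_derivative
          (\<lambda>u. - 2 * coord_sign Y j / (x $ k) ^ 3 * u $ k)) (at x)"
    using assms
    by (auto intro!: derivative_eq_intros bounded_linear.has_derivative[OF bounded_linear_vec_nth]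
        simp: field_simps power2_eq_square power3_eq_cube)
  then have "frechet_derivative (\<lambda>y. coord_sign Y j / (y $ k)\<^sup>2) (at x) =
               (\<lambda>u. - 2 * coord_sign Y j / (x $ k) ^ 3 * u $ k)"
    by (rule frechet_derivative_at[symmetric])
  then show ?thesis
    using True by (simp add: partial_deriv_def half_space_metric_nth axis_def)
next
  case False
  then show ?thesis
    by (simp add: partial_deriv_def half_space_metric_nth)
qed

text \<open>Only derivatives in the direction \<open>k\<close> of diagonal entries survive; raising the index with
  the inverse matrix turns the factor \<open>1 / z\<^sup>3\<close> into \<open>1 / z\<close>.\<close>

lemma christoffel_half_space:
  assumes "x $ k \<noteq> 0" "k \<notin> Y"
  shows "christoffel (half_space_metric Y k) x m i j =
           ((if m = k \<and> i = j then coord_sign Y i else 0)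
             - (if i = k \<and> j = m then 1 else 0) - (if j = k \<and> i = m then 1 else 0)) / x $ k"
proof -
  have k: "coord_sign Y k = 1"
    using assms by (simp add: coord_sign_def)
  have cancel: "(1/2) * (s * z\<^sup>2 * (- 2 / z ^ 3 * (A + B - C))) = s * (C - A - B) / z"
    if "z \<noteq> 0" for s z A B C :: real
    using that by (simp add: field_simps power2_eq_square power3_eq_cube)
  have "christoffel (half_space_metric Y k) x m i j =
     (1/2) * (coord_sign Y m * (x $ k)\<^sup>2 *
        ((if i = k \<and> j = m then - 2 * coord_sign Y j / (x $ k) ^ 3 else 0)
         + (if j = k \<and> i = m then - 2 * coord_sign Y i / (x $ k) ^ 3 else 0)
         - (if m = k \<and> i = j then - 2 * coord_sign Y i / (x $ k) ^ 3 else 0)))"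
    unfolding christoffel_def
    by (simp add: matrix_inv_half_space_metric partial_deriv_half_space_metric assms(1)
        if_distrib[of "\<lambda>u. u * _"] cong: if_cong)
  also have "\<dots> = (1/2) * (coord_sign Y m * (x $ k)\<^sup>2 * (- 2 / (x $ k) ^ 3 *
        ((if i = k \<and> j = m then coord_sign Y m else 0)
         + (if j = k \<and> i = m then coord_sign Y m else 0)
         - (if m = k \<and> i = j then coord_sign Y i else 0))))"
    by (rule arg_cong[where f = "\<lambda>u. 1/2 * (coord_sign Y m * (x $ k)\<^sup>2 * u)"]) simp
  also have "\<dots> = coord_sign Y m *
        ((if m = k \<and> i = j then coord_sign Y i else 0)
         - (if i = k \<and> j = m then coord_sign Y m else 0)
         - (if j = k \<and> i = m then coord_sign Y m else 0)) / x $ k"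
    by (rule cancel) (fact assms(1))
  also have "\<dots> = ((if m = k \<and> i = j then coord_sign Y i else 0)
             - (if i = k \<and> j = m then 1 else 0) - (if j = k \<and> i = m then 1 else 0)) / x $ k"
    by (cases "m = k"; cases "i = k"; cases "j = m"; cases "i = m"; cases "i = j") (simp_all add: k)
  finally show ?thesis .
qed

lemma sum_christoffel_half_space:
  assumes "x $ k \<noteq> 0" "k \<notin> Y"
  shows "(\<Sum>i\<in>UNIV. \<Sum>j\<in>UNIV. christoffel (half_space_metric Y k) x m i j * v $ i * v $ j) =
           ((if m = k then flat_form Y v else 0) - 2 * v $ k * v $ m) / x $ k"
proof -
  have "(\<Sum>j\<in>UNIV. christoffel (half_space_metric Y k) x m i j * v $ i * v $ j) =
          ((if m = k then coord_sign Y i * (v $ i)\<^sup>2 else 0)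
           - (if i = k then v $ k * v $ m else 0) - (if i = m then v $ k * v $ m else 0)) / x $ k" for i
  proof -
    have "(\<Sum>j\<in>UNIV. christoffel (half_space_metric Y k) x m i j * v $ i * v $ j) =
      (\<Sum>j\<in>UNIV. (if j = i then (if m = k then coord_sign Y i * v $ i * v $ i / x $ k else 0) else 0)
        - (if j = m then (if i = k then v $ i * v $ m / x $ k else 0) else 0)
        - (if j = k then (if i = m then v $ i * v $ k / x $ k else 0) else 0))"
      unfolding christoffel_half_space[OF assms]
      by (rule sum.cong[OF refl])
        (auto simp: diff_divide_distrib left_diff_distrib)
    also have "\<dots> = ((if m = k then coord_sign Y i * (v $ i)\<^sup>2 else 0)
           - (if i = k then v $ k * v $ m else 0) - (if i = m then v $ k * v $ m else 0)) / x $ k"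
      by (simp add: sum_subtractf power2_eq_square diff_divide_distrib)
    finally show ?thesis .
  qed
  then show ?thesis
    by (simp add: sum_divide_distrib[symmetric] sum_subtractf flat_form_def)
qed

text \<open>Contracting the Christoffel symbols with the velocity gives a multiple of the velocity, as
  for a reparametrized straight line, and a vertical term that vanishes on isotropic vectors.\<close>

lemma geodesic_param_half_space_iff:
  assumes "k \<notin> Y"
  shows "geodesic_param (half_space_metric Y k) (half_space k) I c \<longleftrightarrow>
    open I \<and> is_interval I \<and> c ` I \<subseteq> half_space k \<and> \<not> c constant_on I \<and>
    (\<exists>v a. \<forall>t\<in>I. (c has_vector_derivative v t) (at t) \<and> (v has_vector_derivative a t) (at t) \<and>
       a t = (2 * v t $ k / c t $ k) *\<^sub>R v t - (flat_form Y (v t) / c t $ k) *\<^sub>R axis k 1)"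
proof -
  have "(\<forall>m. a t $ m + (\<Sum>i\<in>UNIV. \<Sum>j\<in>UNIV.
            christoffel (half_space_metric Y k) (c t) m i j * v t $ i * v t $ j) = 0) \<longleftrightarrow>
        a t = (2 * v t $ k / c t $ k) *\<^sub>R v t - (flat_form Y (v t) / c t $ k) *\<^sub>R axis k 1"
    if "c t $ k > 0" for v a :: "real \<Rightarrow> real^'a" and t
    using that assms
    by (simp add: sum_christoffel_half_space vec_eq_iff axis_def if_distrib[of "\<lambda>u. _ * u"]
        diff_divide_distrib eq_diff_eq add.commute add_diff_eq cong: if_cong)
  then have eq: "((c has_vector_derivative v t) (at t) \<and> (v has_vector_derivative a t) (at t) \<and>
       (\<forall>m. a t $ m + (\<Sum>i\<in>UNIV. \<Sum>j\<in>UNIV.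
            christoffel (half_space_metric Y k) (c t) m i j * v t $ i * v t $ j) = 0)) \<longleftrightarrow>
      ((c has_vector_derivative v t) (at t) \<and> (v has_vector_derivative a t) (at t) \<and>
       a t = (2 * v t $ k / c t $ k) *\<^sub>R v t - (flat_form Y (v t) / c t $ k) *\<^sub>R axis k 1)"
    if "c ` I \<subseteq> half_space k" "t \<in> I" for v a t
    using that by (simp add: half_space_def image_subset_iff)
  show ?thesis
    unfolding geodesic_param_def
  proof (intro conj_cong refl)
    assume "c ` I \<subseteq> half_space k"
    note eq = eq[OF this]
    show "(\<exists>v a. \<forall>t\<in>I. (c has_vector_derivative v t) (at t) \<and>
        (v has_vector_derivative a t) (at t) \<and>
        (\<forall>m. a t $ m + (\<Sum>i\<in>UNIV. \<Sum>j\<in>UNIV.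
            christoffel (half_space_metric Y k) (c t) m i j * v t $ i * v t $ j) = 0)) \<longleftrightarrow>
      (\<exists>v a. \<forall>t\<in>I. (c has_vector_derivative v t) (at t) \<and> (v has_vector_derivative a t) (at t) \<and>
       a t = (2 * v t $ k / c t $ k) *\<^sub>R v t - (flat_form Y (v t) / c t $ k) *\<^sub>R axis k 1)"
      by (rule ex_cong1, rule ex_cong1, rule ball_cong[OF refl], rule eq)
  qed
qed



section \<open>Integration of the lightlike geodesics\<close>

text \<open>The solution of \<open>z \<cdot> c'' = 2 z' c'\<close> with value \<open>x\<close> and velocity \<open>V\<close> at time \<open>t\<^sub>0\<close>.\<close>

definition null_curve :: "'n::finite \<Rightarrow> real^'n \<Rightarrow> real^'n \<Rightarrow> real \<Rightarrow> real \<Rightarrow> real^'n" where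
  "null_curve k x V t\<^sub>0 t = x + ((t - t\<^sub>0) * x $ k / (x $ k - (t - t\<^sub>0) * V $ k)) *\<^sub>R V"

text \<open>All real numbers if \<open>V\<^sub>k = 0\<close>; otherwise the side of \<open>t\<^sub>0\<close> of the pole of the curve, where
  its height becomes infinite.\<close>

definition null_domain :: "'n::finite \<Rightarrow> real^'n \<Rightarrow> real^'n \<Rightarrow> real \<Rightarrow> real set" where
  "null_domain k x V t\<^sub>0 = {t. (t - t\<^sub>0) * V $ k < x $ k}"

lemma null_curve_height:
  assumes "t \<in> null_domain k x V t\<^sub>0"
  shows "null_curve k x V t\<^sub>0 t $ k = (x $ k)\<^sup>2 / (x $ k - (t - t\<^sub>0) * V $ k)"
  using assms
  by (simp add: null_domain_def null_curve_def divide_simps)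
    (simp add: algebra_simps power2_eq_square)

lemma null_curve_has_vector_derivative:
  assumes "t \<in> null_domain k x V t\<^sub>0"
  shows "(null_curve k x V t\<^sub>0 has_vector_derivative
           (x $ k / (x $ k - (t - t\<^sub>0) * V $ k))\<^sup>2 *\<^sub>R V) (at t)"
proof -
  let ?f = "\<lambda>t. (t - t\<^sub>0) * x $ k / (x $ k - (t - t\<^sub>0) * V $ k)"
  have "(?f has_real_derivative (x $ k / (x $ k - (t - t\<^sub>0) * V $ k))\<^sup>2) (at t)"
    using assms unfolding null_domain_def
    by (auto intro!: derivative_eq_intros simp: power2_eq_square) (simp add: algebra_simps)
  then have "((\<lambda>t. x + ?f t *\<^sub>R V) has_vector_derivative
       0 + (?f t *\<^sub>R 0 + (x $ k / (x $ k - (t - t\<^sub>0) * V $ k))\<^sup>2 *\<^sub>R V)) (at t)"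
    by (intro has_vector_derivative_add has_vector_derivative_const has_vector_derivative_scaleR)
  then show ?thesis
    by (simp add: null_curve_def[abs_def])
qed

lemma null_curve_velocity_has_vector_derivative:
  assumes "t \<in> null_domain k x V t\<^sub>0"
  shows "((\<lambda>t. (x $ k / (x $ k - (t - t\<^sub>0) * V $ k))\<^sup>2 *\<^sub>R V) has_vector_derivative
           (2 * V $ k * (x $ k)\<^sup>2 / (x $ k - (t - t\<^sub>0) * V $ k) ^ 3) *\<^sub>R V) (at t)"
proof -
  let ?f = "\<lambda>t. (x $ k / (x $ k - (t - t\<^sub>0) * V $ k))\<^sup>2"
  have "(?f has_real_derivative 2 * V $ k * (x $ k)\<^sup>2 / (x $ k - (t - t\<^sub>0) * V $ k) ^ 3) (at t)"
    using assms unfolding null_domain_def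
    by (auto intro!: derivative_eq_intros simp: power2_eq_square power3_eq_cube) (simp add: mult_ac)
  then have "((\<lambda>t. ?f t *\<^sub>R V) has_vector_derivative
      ?f t *\<^sub>R 0 + (2 * V $ k * (x $ k)\<^sup>2 / (x $ k - (t - t\<^sub>0) * V $ k) ^ 3) *\<^sub>R V) (at t)"
    by (intro has_vector_derivative_const has_vector_derivative_scaleR)
  then show ?thesis
    by simp
qed

lemma geodesic_param_in: "geodesic_param g U I c \<Longrightarrow> t \<in> I \<Longrightarrow> c t \<in> U"
  unfolding geodesic_param_def by blast

lemma constant_on_imp_vector_derivative_zero:
  fixes c :: "real \<Rightarrow> 'a::real_normed_vector"
  assumes "c constant_on I" "open I" "t \<in> I" "(c has_vector_derivative v) (at t)"
  shows "v = 0"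
proof -
  obtain y where y: "\<And>s. s \<in> I \<Longrightarrow> c s = y"
    using assms(1) by (auto simp: constant_on_def)
  have "((\<lambda>_. y) has_vector_derivative v) (at t)"
    by (rule has_vector_derivative_transform_within_open[OF assms(4,2,3)]) (rule y)
  then show ?thesis
    using vector_derivative_unique_at has_vector_derivative_const by blast
qed

lemma null_domain_open_interval:
  "open (null_domain k x V t\<^sub>0)" "is_interval (null_domain k x V t\<^sub>0)"
proof -
  show "open (null_domain k x V t\<^sub>0)"
    unfolding null_domain_def by (intro open_Collect_less continuous_intros)
  have "convex {t. V $ k * t < x $ k + t\<^sub>0 * V $ k}"
    using convex_halfspace_lt[of "V $ k" "x $ k + t\<^sub>0 * V $ k"] by simp
  also have "{t. V $ k * t < x $ k + t\<^sub>0 * V $ k} = null_domain k x V t\<^sub>0"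
    by (auto simp: null_domain_def algebra_simps)
  finally show "is_interval (null_domain k x V t\<^sub>0)"
    by (simp add: is_interval_convex_1)
qed

lemma geodesic_param_null_curve:
  assumes "k \<notin> Y" "x \<in> half_space k" "V \<noteq> 0" "flat_form Y V = 0"
  shows "geodesic_param (half_space_metric Y k) (half_space k)
           (null_domain k x V t\<^sub>0) (null_curve k x V t\<^sub>0)"
proof -
  let ?I = "null_domain k x V t\<^sub>0" and ?c = "null_curve k x V t\<^sub>0"
  let ?v = "\<lambda>t. (x $ k / (x $ k - (t - t\<^sub>0) * V $ k))\<^sup>2 *\<^sub>R V"
  let ?a = "\<lambda>t. (2 * V $ k * (x $ k)\<^sup>2 / (x $ k - (t - t\<^sub>0) * V $ k) ^ 3) *\<^sub>R V"
  have h: "x $ k > 0"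
    using assms(2) by (simp add: half_space_def)
  have "t\<^sub>0 \<in> ?I"
    using h by (simp add: null_domain_def)
  then have "\<not> ?c constant_on ?I"
    using constant_on_imp_vector_derivative_zero[OF _ null_domain_open_interval(1) _
        null_curve_has_vector_derivative[OF \<open>t\<^sub>0 \<in> ?I\<close>]] h assms(3) by auto
  moreover have "?c ` ?I \<subseteq> half_space k"
    using h by (auto simp: half_space_def null_curve_height null_domain_def)
  moreover have "?a t = (2 * ?v t $ k / ?c t $ k) *\<^sub>R ?v t - (flat_form Y (?v t) / ?c t $ k) *\<^sub>R axis k 1"
    if t: "t \<in> ?I" for t
  proof -
    have cancel: "2 * w * h\<^sup>2 / d ^ 3 = 2 * ((h / d)\<^sup>2 * w) / (h\<^sup>2 / d) * (h / d)\<^sup>2"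
      if "h > 0" "d > 0" for h d w :: real
      using that by (simp add: field_simps power2_eq_square power3_eq_cube)
    have "x $ k - (t - t\<^sub>0) * V $ k > 0"
      using t by (simp add: null_domain_def)
    from cancel[OF h this] show ?thesis
      by (simp add: null_curve_height[OF t] flat_form_scaleR assms(4))
  qed
  ultimately show ?thesis
    unfolding geodesic_param_half_space_iff[OF assms(1)]
    by (intro conjI exI[of _ ?v] exI[of _ ?a] ballI null_domain_open_interval
        null_curve_has_vector_derivative null_curve_velocity_has_vector_derivative)
qed

lemma zero_derivative_on_interval_const:
  fixes f :: "real \<Rightarrow> 'a::real_normed_vector"
  assumes "is_interval I" "\<And>t. t \<in> I \<Longrightarrow> (f has_vector_derivative 0) (at t)" "t \<in> I" "s \<in> I"
  shows "f t = f s"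
proof -
  obtain y where "\<And>t. t \<in> I \<Longrightarrow> f t = y"
    using has_vector_derivative_zero_constant[of I f] assms(1,2)
    by (metis has_vector_derivative_at_within is_interval_convex_1)
  then show ?thesis
    using assms(3,4) by simp
qed

lemma flat_form_has_real_derivative:
  assumes "(v has_vector_derivative a) (at t)"
  shows "((\<lambda>t. flat_form Y (v t)) has_real_derivative
           2 * (\<Sum>i\<in>UNIV. coord_sign Y i * v t $ i * a $ i)) (at t)"
proof -
  have "((\<lambda>t. v t $ i) has_real_derivative a $ i) (at t)" for i
    using bounded_linear.has_vector_derivative[OF bounded_linear_vec_nth assms]
    by (simp add: has_real_derivative_iff_has_vector_derivative)
  then have "((\<lambda>t. \<Sum>i\<in>UNIV. coord_sign Y i * (v t $ i)\<^sup>2) has_real_derivative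
      (\<Sum>i\<in>UNIV. coord_sign Y i * (2 * (v t $ i * a $ i)))) (at t)"
    by (intro DERIV_sum DERIV_cmult) (auto intro!: derivative_eq_intros)
  then show ?thesis
    by (simp add: flat_form_def sum_distrib_left mult_ac)
qed

text \<open>Uniqueness is obtained by explicit integration, so that the bound on the interval of
  definition comes out along with the formula. Isotropy is needed at a single time only, because
  the length of the velocity is conserved.\<close>

lemma null_geodesic_eq_null_curve:
  fixes c :: "real \<Rightarrow> real^'n::finite"
  assumes "k \<notin> Y" and geo: "geodesic_param (half_space_metric Y k) (half_space k) I c"
    and t\<^sub>0: "t\<^sub>0 \<in> I"
    and V: "(c has_vector_derivative V) (at t\<^sub>0)" and null: "flat_form Y V = 0"
  shows "V \<noteq> 0" "I \<subseteq> null_domain k (c t\<^sub>0) V t\<^sub>0"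
    "\<And>t. t \<in> I \<Longrightarrow> c t = null_curve k (c t\<^sub>0) V t\<^sub>0 t"
proof -
  note geo = geo[unfolded geodesic_param_half_space_iff[OF assms(1)]]
  from geo obtain v a where eqn: "\<forall>t\<in>I. (c has_vector_derivative v t) (at t) \<and>
      (v has_vector_derivative a t) (at t) \<and>
      a t = (2 * v t $ k / c t $ k) *\<^sub>R v t - (flat_form Y (v t) / c t $ k) *\<^sub>R axis k 1"
    by (elim conjE exE) rule
  from geo have I: "is_interval I" and noncst: "\<not> c constant_on I"
    and pos: "\<And>t. t \<in> I \<Longrightarrow> c t $ k > 0"
    by (simp_all add: half_space_def image_subset_iff)
  have c': "(c has_vector_derivative v t) (at t)" if "t \<in> I" for t
    using eqn that by blast
  have v': "(v has_vector_derivative a t) (at t)" if "t \<in> I" for t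
    using eqn that by blast
  have a: "a t = (2 * v t $ k / c t $ k) *\<^sub>R v t - (flat_form Y (v t) / c t $ k) *\<^sub>R axis k 1"
    if "t \<in> I" for t
    using eqn that by blast
  have z': "((\<lambda>t. c t $ k) has_real_derivative v t $ k) (at t)" if "t \<in> I" for t
    using bounded_linear.has_vector_derivative[OF bounded_linear_vec_nth c'[OF that]]
    by (simp add: has_real_derivative_iff_has_vector_derivative)
  have vt\<^sub>0: "v t\<^sub>0 = V"
    using vector_derivative_unique_at[OF c'[OF t\<^sub>0] V] .
  define h where "h = c t\<^sub>0 $ k"
  have h: "h > 0"
    using pos[OF t\<^sub>0] by (simp add: h_def)

  \<comment> \<open>The first integral of length: \<open>\<eta>(v, a) = v\<^sub>k \<eta>(v, v) / z\<close>.\<close>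
  have conserved: "((\<lambda>t. flat_form Y (v t) / (c t $ k)\<^sup>2) has_real_derivative 0) (at t)"
    if t: "t \<in> I" for t
  proof -
    have "(\<Sum>i\<in>UNIV. coord_sign Y i * v t $ i * a t $ i) =
      (\<Sum>i\<in>UNIV. 2 * v t $ k / c t $ k * (coord_sign Y i * (v t $ i)\<^sup>2)
         - (if i = k then flat_form Y (v t) / c t $ k * v t $ k else 0))"
      using assms(1) unfolding a[OF t]
      by (intro sum.cong) (auto simp: axis_def coord_sign_def algebra_simps power2_eq_square)
    also have "\<dots> = v t $ k * flat_form Y (v t) / c t $ k"
      by (simp add: sum_subtractf flat_form_def sum_distrib_left[symmetric] sum_divide_distrib[symmetric])
    finally have sum_eq: "(\<Sum>i\<in>UNIV. coord_sign Y i * v t $ i * a t $ i) =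
      v t $ k * flat_form Y (v t) / c t $ k" .
    show ?thesis
      using pos[OF t] flat_form_has_real_derivative[OF v'[OF t], of Y, unfolded sum_eq] z'[OF t]
      by (auto intro!: derivative_eq_intros simp: field_simps power2_eq_square)
  qed
  have null_everywhere: "flat_form Y (v t) = 0" if "t \<in> I" for t
  proof -
    have "flat_form Y (v t) / (c t $ k)\<^sup>2 = flat_form Y (v t\<^sub>0) / (c t\<^sub>0 $ k)\<^sup>2"
      by (rule zero_derivative_on_interval_const[OF I _ that t\<^sub>0])
        (use conserved in \<open>simp add: has_real_derivative_iff_has_vector_derivative\<close>)
    then show ?thesis
      using null vt\<^sub>0 pos[OF that] by simp
  qed

  \<comment> \<open>The vector \<open>v / z\<^sup>2\<close> is constant, since \<open>a = 2 (v\<^sub>k / z) v\<close>.\<close>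
  have velocity: "v t = (c t $ k / h)\<^sup>2 *\<^sub>R V" if t: "t \<in> I" for t
  proof -
    have "((\<lambda>t. (1 / (c t $ k)\<^sup>2) *\<^sub>R v t) has_vector_derivative 0) (at t)" if t: "t \<in> I" for t
    proof -
      have "((\<lambda>t. 1 / (c t $ k)\<^sup>2) has_real_derivative - 2 * v t $ k / (c t $ k) ^ 3) (at t)"
        using pos[OF t] z'[OF t]
        by (auto intro!: derivative_eq_intros simp: field_simps power2_eq_square power3_eq_cube)
      from has_vector_derivative_scaleR[OF this v'[OF t]] show ?thesis
        using pos[OF t]
        by (simp add: a[OF t] null_everywhere[OF t] power2_eq_square power3_eq_cube
            flip: scaleR_left.add)
    qed
    from zero_derivative_on_interval_const[OF I this t t\<^sub>0]
    have "(1 / (c t $ k)\<^sup>2) *\<^sub>R v t = (1 / h\<^sup>2) *\<^sub>R V"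
      by (simp add: h_def vt\<^sub>0)
    then have "(c t $ k)\<^sup>2 *\<^sub>R ((1 / (c t $ k)\<^sup>2) *\<^sub>R v t) = (c t $ k)\<^sup>2 *\<^sub>R ((1 / h\<^sup>2) *\<^sub>R V)"
      by simp
    then show ?thesis
      using pos[OF t] by (simp add: power_divide)
  qed

  \<comment> \<open>The derivative of \<open>1 / z\<close> is \<open>- v\<^sub>k / z\<^sup>2\<close>, which is now known to be \<open>- V\<^sub>k / h\<^sup>2\<close>.\<close>
  have height: "c t $ k * (h - (t - t\<^sub>0) * V $ k) = h\<^sup>2" if t: "t \<in> I" for t
  proof -
    have "((\<lambda>t. 1 / c t $ k + t * V $ k / h\<^sup>2) has_real_derivative 0) (at t)" if t: "t \<in> I" for t
      using pos[OF t] h z'[OF t]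
      by (auto intro!: derivative_eq_intros simp: velocity[OF t] field_simps power2_eq_square)
    then have "1 / c t $ k + t * V $ k / h\<^sup>2 = 1 / c t\<^sub>0 $ k + t\<^sub>0 * V $ k / h\<^sup>2"
      using zero_derivative_on_interval_const[OF I _ t t\<^sub>0, of "\<lambda>t. 1 / c t $ k + t * V $ k / h\<^sup>2"]
      by (simp add: has_real_derivative_iff_has_vector_derivative)
    then have "1 / c t $ k = (h - (t - t\<^sub>0) * V $ k) / h\<^sup>2"
      using h by (simp add: h_def[symmetric] diff_divide_distrib left_diff_distrib power2_eq_square)
    then show ?thesis
      using pos[OF t] h by (simp add: frac_eq_eq mult.commute)
  qed
  show dom: "I \<subseteq> null_domain k (c t\<^sub>0) V t\<^sub>0"
  proof
    fix t assume t: "t \<in> I"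
    have "c t $ k * (h - (t - t\<^sub>0) * V $ k) > 0"
      using height[OF t] h by simp
    then have "h - (t - t\<^sub>0) * V $ k > 0"
      using pos[OF t] by (simp add: zero_less_mult_iff)
    then show "t \<in> null_domain k (c t\<^sub>0) V t\<^sub>0"
      by (simp add: null_domain_def h_def)
  qed

  show eq: "c t = null_curve k (c t\<^sub>0) V t\<^sub>0 t" if t: "t \<in> I" for t
  proof -
    have "((\<lambda>t. c t - null_curve k (c t\<^sub>0) V t\<^sub>0 t) has_vector_derivative 0) (at t)"
      if t: "t \<in> I" for t
    proof -
      have "h - (t - t\<^sub>0) * V $ k > 0"
        using dom t by (auto simp: null_domain_def h_def)
      then have "c t $ k / h = h / (h - (t - t\<^sub>0) * V $ k)"
        using height[OF t] h by (simp add: frac_eq_eq power2_eq_square)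
      then show ?thesis
        using has_vector_derivative_diff[OF c'[OF t] null_curve_has_vector_derivative[OF subsetD[OF dom t]]]
        by (simp add: velocity[OF t] h_def)
    qed
    from zero_derivative_on_interval_const[OF I this t t\<^sub>0]
    have "c t - null_curve k (c t\<^sub>0) V t\<^sub>0 t = c t\<^sub>0 - null_curve k (c t\<^sub>0) V t\<^sub>0 t\<^sub>0"
      by simp
    also have "null_curve k (c t\<^sub>0) V t\<^sub>0 t\<^sub>0 = c t\<^sub>0"
      by (simp add: null_curve_def)
    finally show ?thesis
      by simp
  qed

  show "V \<noteq> 0"
  proof
    assume "V = 0"
    then have "c t = c t\<^sub>0" if "t \<in> I" for t
      using eq[OF that] by (simp add: null_curve_def)
    then show False
      using noncst by (auto simp: constant_on_def)
  qed
qed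

lemma null_curve_start [simp]: "null_curve k x V t\<^sub>0 t\<^sub>0 = x"
  by (simp add: null_curve_def)

lemma start_in_null_domain: "x \<in> half_space k \<Longrightarrow> t\<^sub>0 \<in> null_domain k x V t\<^sub>0"
  by (simp add: null_domain_def half_space_def)

lemma null_curve_start_velocity:
  assumes "x \<in> half_space k"
  shows "(null_curve k x V t\<^sub>0 has_vector_derivative V) (at t\<^sub>0)"
  using null_curve_has_vector_derivative[OF start_in_null_domain[OF assms], of V t\<^sub>0] assms
  by (simp add: half_space_def)

text \<open>Any extension has the same initial data at \<open>t\<^sub>0\<close>, so it cannot leave the domain either.\<close>

lemma maximal_geodesic_param_null_curve:
  assumes "k \<notin> Y" "x \<in> half_space k" "V \<noteq> 0" "flat_form Y V = 0"
  shows "maximal_geodesic_param (half_space_metric Y k) (half_space k)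
           (null_domain k x V t\<^sub>0) (null_curve k x V t\<^sub>0)"
  unfolding maximal_geodesic_param_def
proof (intro conjI allI impI)
  show "geodesic_param (half_space_metric Y k) (half_space k)
           (null_domain k x V t\<^sub>0) (null_curve k x V t\<^sub>0)"
    by (rule geodesic_param_null_curve[OF assms])
  fix J c
  assume ext: "geodesic_param (half_space_metric Y k) (half_space k) J c \<and>
    null_domain k x V t\<^sub>0 \<subseteq> J \<and> (\<forall>t\<in>null_domain k x V t\<^sub>0. c t = null_curve k x V t\<^sub>0 t)"
  note t\<^sub>0 = start_in_null_domain[OF assms(2)]
  have "(c has_vector_derivative V) (at t\<^sub>0)"
    by (rule has_vector_derivative_transform_within_open[OF null_curve_start_velocity[OF assms(2)]
          null_domain_open_interval(1) t\<^sub>0[of t\<^sub>0 V]]) (use ext in simp)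
  moreover have "c t\<^sub>0 = x"
    using ext t\<^sub>0 by simp
  ultimately have "J \<subseteq> null_domain k x V t\<^sub>0"
    using null_geodesic_eq_null_curve(2)[OF assms(1) _ _ _ assms(4)] ext t\<^sub>0 by blast
  then show "J = null_domain k x V t\<^sub>0"
    using ext by blast
qed

lemma maximal_null_geodesic_domain:
  assumes "k \<notin> Y" and max: "maximal_geodesic_param (half_space_metric Y k) (half_space k) I c"
    and t\<^sub>0: "t\<^sub>0 \<in> I" and V: "(c has_vector_derivative V) (at t\<^sub>0)" "flat_form Y V = 0"
  shows "I = null_domain k (c t\<^sub>0) V t\<^sub>0"
proof -
  have geo: "geodesic_param (half_space_metric Y k) (half_space k) I c"
    using max by (simp add: maximal_geodesic_param_def)
  then have "c t\<^sub>0 \<in> half_space k"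
    by (rule geodesic_param_in[OF _ t\<^sub>0])
  note curve = null_geodesic_eq_null_curve[OF assms(1) geo t\<^sub>0 V]
  have "geodesic_param (half_space_metric Y k) (half_space k)
      (null_domain k (c t\<^sub>0) V t\<^sub>0) (null_curve k (c t\<^sub>0) V t\<^sub>0)"
    by (rule geodesic_param_null_curve) fact+
  then have "null_domain k (c t\<^sub>0) V t\<^sub>0 = I"
    using max curve(2,3) unfolding maximal_geodesic_param_def by (metis (no_types, lifting))
  then show ?thesis ..
qed


section \<open>Lightlike geodesics are lightlike lines\<close>

abbreviation (input) half_space_line :: "'n::finite \<Rightarrow> real^'n \<Rightarrow> real^'n \<Rightarrow> (real^'n) set" where
  "half_space_line k x V \<equiv> range (\<lambda>r::real. x + r *\<^sub>R V) \<inter> half_space k"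

text \<open>The change of parameter \<open>r = s h / (h - s V\<^sub>k)\<close> has the inverse \<open>s = r h / (h + r V\<^sub>k)\<close>, and the
  two denominators have product \<open>h\<^sup>2\<close>, so they are positive simultaneously.\<close>

lemma null_curve_image:
  assumes "x \<in> half_space k"
  shows "null_curve k x V t\<^sub>0 ` null_domain k x V t\<^sub>0 = half_space_line k x V"
proof (intro equalityI subsetI)
  have h: "x $ k > 0"
    using assms by (simp add: half_space_def)
  {
    fix y assume "y \<in> null_curve k x V t\<^sub>0 ` null_domain k x V t\<^sub>0"
    then obtain t where t: "t \<in> null_domain k x V t\<^sub>0" "y = null_curve k x V t\<^sub>0 t"
      by blast
    then have "y $ k > 0"
      using h by (simp add: null_curve_height) (simp add: null_domain_def)
    then show "y \<in> half_space_line k x V"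
      using t(2) by (auto simp: null_curve_def half_space_def)
  next
    fix y assume "y \<in> half_space_line k x V"
    then obtain r where r: "y = x + r *\<^sub>R V" "x $ k + r * V $ k > 0"
      unfolding half_space_def by fastforce
    define s where "s = r * x $ k / (x $ k + r * V $ k)"
    have gap: "x $ k - s * V $ k = (x $ k)\<^sup>2 / (x $ k + r * V $ k)"
      using r(2) unfolding s_def by (simp add: divide_simps) (simp add: algebra_simps power2_eq_square)
    have "x $ k - s * V $ k > 0"
      unfolding gap using h r(2) by simp
    then have "t\<^sub>0 + s \<in> null_domain k x V t\<^sub>0"
      by (simp add: null_domain_def)
    moreover have "s * x $ k / (x $ k - s * V $ k) = r"
      unfolding gap using h r(2) by (simp add: s_def power2_eq_square)
    then have "null_curve k x V t\<^sub>0 (t\<^sub>0 + s) = y"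
      by (simp add: null_curve_def r(1))
    ultimately show "y \<in> null_curve k x V t\<^sub>0 ` null_domain k x V t\<^sub>0"
      by blast
  }
qed

lemma geodesic_param_velocity:
  assumes "geodesic_param g U I c" "t \<in> I"
  obtains v where "(c has_vector_derivative v) (at t)"
  using assms unfolding geodesic_param_def by blast

lemma geodesic_param_nonempty: "geodesic_param g U I c \<Longrightarrow> I \<noteq> {}"
  by (auto simp: geodesic_param_def constant_on_def)

lemma lightlike_geodesic_half_space_iff:
  fixes S :: "(real^'n::finite) set"
  assumes "k \<notin> Y"
  shows "lightlike_geodesic (half_space_metric Y k) (half_space k) S \<longleftrightarrow>
    (\<exists>x V. x \<in> half_space k \<and> V \<noteq> 0 \<and> flat_form Y V = 0 \<and> S = half_space_line k x V)"
proof
  assume "lightlike_geodesic (half_space_metric Y k) (half_space k) S"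
  then obtain I c where max: "maximal_geodesic_param (half_space_metric Y k) (half_space k) I c"
    and S: "S = c ` I"
    and null: "\<And>t. t \<in> I \<Longrightarrow> flat_form Y (vector_derivative c (at t)) / (c t $ k)\<^sup>2 = 0"
    by (auto simp: lightlike_geodesic_def half_space_metric_quadratic_form)
  have geo: "geodesic_param (half_space_metric Y k) (half_space k) I c"
    using max by (simp add: maximal_geodesic_param_def)
  obtain t\<^sub>0 where t\<^sub>0: "t\<^sub>0 \<in> I"
    using geodesic_param_nonempty[OF geo] by blast
  obtain V where V: "(c has_vector_derivative V) (at t\<^sub>0)"
    using geodesic_param_velocity[OF geo t\<^sub>0] .
  have x: "c t\<^sub>0 \<in> half_space k"
    by (rule geodesic_param_in[OF geo t\<^sub>0])
  have flat: "flat_form Y V = 0"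
    using null[OF t\<^sub>0] x by (simp add: vector_derivative_at[OF V] half_space_def)
  note curve = null_geodesic_eq_null_curve[OF assms geo t\<^sub>0 V flat]
  have "S = null_curve k (c t\<^sub>0) V t\<^sub>0 ` I"
    unfolding S by (rule image_cong[OF refl curve(3)])
  then have "S = half_space_line k (c t\<^sub>0) V"
    unfolding maximal_null_geodesic_domain[OF assms max t\<^sub>0 V flat] null_curve_image[OF x] .
  then show "\<exists>x V. x \<in> half_space k \<and> V \<noteq> 0 \<and> flat_form Y V = 0 \<and> S = half_space_line k x V"
    using x curve(1) flat by blast
next
  assume "\<exists>x V. x \<in> half_space k \<and> V \<noteq> 0 \<and> flat_form Y V = 0 \<and> S = half_space_line k x V"
  then obtain x V where x: "x \<in> half_space k" and V: "V \<noteq> 0" "flat_form Y V = 0"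
    and S: "S = half_space_line k x V"
    by blast
  have "vector_derivative (null_curve k x V 0) (at t) \<bullet>
      (half_space_metric Y k (null_curve k x V 0 t) *v vector_derivative (null_curve k x V 0) (at t)) = 0"
    if "t \<in> null_domain k x V 0" for t
    unfolding half_space_metric_quadratic_form
      vector_derivative_at[OF null_curve_has_vector_derivative[OF that]]
    by (simp add: flat_form_scaleR V(2))
  then show "lightlike_geodesic (half_space_metric Y k) (half_space k) S"
    unfolding lightlike_geodesic_def S null_curve_image[OF x, of V 0, symmetric]
    using maximal_geodesic_param_null_curve[OF assms x V, of 0] by blast
qed


section \<open>The ends of a lightlike line\<close>

lemma eventually_forward_end:
  assumes "I \<noteq> {}"
  shows "eventually P (forward_end I c) \<longleftrightarrow> (\<exists>s\<in>I. \<forall>t\<in>I. s < t \<longrightarrow> P (c t))"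
proof -
  have "\<exists>u\<in>I. principal (c ` (I \<inter> {u<..})) \<le> inf (principal (c ` (I \<inter> {s<..}))) (principal (c ` (I \<inter> {t<..})))"
    if "s \<in> I" "t \<in> I" for s t
    using that by (intro bexI[of _ "max s t"]) (auto simp: max_def)
  then show ?thesis
    unfolding forward_end_def
    by (subst eventually_INF_base[OF assms]) (auto simp: eventually_principal)
qed

text \<open>The end of a line at infinite height, described without a parametrization. This is what
  makes the escaping end unique: all parametrizations running upwards yield this same filter.\<close>

definition top_end :: "'n::finite \<Rightarrow> (real^'n) set \<Rightarrow> (real^'n) filter" where
  "top_end k S = (INF r\<in>{0<..}. principal {y \<in> S. r < y $ k})"

lemma eventually_top_end:
  "eventually P (top_end k S) \<longleftrightarrow> (\<exists>r>0. \<forall>y\<in>S. r < y $ k \<longrightarrow> P y)"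
proof -
  have "\<exists>u\<in>{0<..}. principal {y \<in> S. u < y $ k} \<le>
      inf (principal {y \<in> S. s < y $ k}) (principal {y \<in> S. t < y $ k})"
    if "s \<in> {0<..}" "t \<in> {0<..}" for s t :: real
    using that by (intro bexI[of _ "max s t"]) auto
  then show ?thesis
    unfolding top_end_def
    by (subst eventually_INF_base) (auto simp: eventually_principal)
qed

lemma top_end_escapes_compacts: "escapes_compacts M (top_end k S)"
  unfolding escapes_compacts_def
proof (intro allI impI)
  fix K :: "(real^'a) set" assume "compact K \<and> K \<subseteq> M"
  then obtain B where B: "\<And>y. y \<in> K \<Longrightarrow> norm y \<le> B"
    using compact_imp_bounded bounded_iff by metis
  have "y \<notin> K" if "max B 1 < y $ k" for y
    using B[of y] component_le_norm_cart[of y k] that by fastforce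
  then show "\<forall>\<^sub>F y in top_end k S. y \<notin> K"
    unfolding eventually_top_end by (intro exI[of _ "max B 1"]) auto
qed

text \<open>Along such a geodesic the height is a strictly increasing bijection from the parameter
  interval onto the positive reals, which matches the tails of the parametrization with the parts
  of its image above given heights.\<close>

lemma forward_end_rising_null_geodesic:
  assumes "k \<notin> Y" and max: "maximal_geodesic_param (half_space_metric Y k) (half_space k) I c"
    and t\<^sub>0: "t\<^sub>0 \<in> I" and V: "(c has_vector_derivative V) (at t\<^sub>0)" "flat_form Y V = 0"
    and w: "V $ k > 0"
  shows "forward_end I c = top_end k (c ` I)"
proof -
  define h where "h = c t\<^sub>0 $ k"
  have nonempty: "I \<noteq> {}"
    using t\<^sub>0 by blast
  have geo: "geodesic_param (half_space_metric Y k) (half_space k) I c"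
    using max by (simp add: maximal_geodesic_param_def)
  have h: "h > 0"
    using geodesic_param_in[OF geo t\<^sub>0] by (simp add: half_space_def h_def)
  have I: "I = null_domain k (c t\<^sub>0) V t\<^sub>0"
    by (rule maximal_null_geodesic_domain[OF assms(1-5)])
  have gap: "h - (t - t\<^sub>0) * V $ k > 0" if "t \<in> I" for t
    using that by (simp add: I null_domain_def h_def)
  have height: "c t $ k = h\<^sup>2 / (h - (t - t\<^sub>0) * V $ k)" if "t \<in> I" for t
    using null_geodesic_eq_null_curve(3)[OF assms(1) geo t\<^sub>0 V that] null_curve_height that
    by (simp add: I h_def)
  have pos: "c t $ k > 0" if "t \<in> I" for t
    using gap[OF that] h by (simp add: height[OF that])
  have mono: "c s $ k < c t $ k \<longleftrightarrow> s < t" if "s \<in> I" "t \<in> I" for s t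
  proof -
    have "c s $ k < c t $ k \<longleftrightarrow> h - (t - t\<^sub>0) * V $ k < h - (s - t\<^sub>0) * V $ k"
      unfolding height[OF that(1)] height[OF that(2)] divide_inverse
        mult_less_cancel_left_pos[OF zero_less_power[OF h]]
      by (rule inverse_less_iff_less[OF gap[OF that(1)] gap[OF that(2)]])
    also have "\<dots> \<longleftrightarrow> s < t"
      using w by simp
    finally show ?thesis .
  qed
  have onto: "\<exists>s\<in>I. c s $ k = r" if "r > 0" for r
  proof -
    define s where "s = t\<^sub>0 + (h - h\<^sup>2 / r) / V $ k"
    have eq: "h - (s - t\<^sub>0) * V $ k = h\<^sup>2 / r"
      using w by (simp add: s_def)
    moreover have "h\<^sup>2 / r > 0"
      using h that by simp
    ultimately have "s \<in> I"
      by (simp add: I null_domain_def h_def[symmetric])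
    moreover have "c s $ k = r"
      unfolding height[OF \<open>s \<in> I\<close>] eq using h by simp
    ultimately show ?thesis ..
  qed
  have "(\<exists>s\<in>I. \<forall>t\<in>I. s < t \<longrightarrow> P (c t)) \<longleftrightarrow> (\<exists>r>0. \<forall>y\<in>c ` I. r < y $ k \<longrightarrow> P y)" for P
  proof
    assume "\<exists>s\<in>I. \<forall>t\<in>I. s < t \<longrightarrow> P (c t)"
    then obtain s where "s \<in> I" "\<forall>t\<in>I. s < t \<longrightarrow> P (c t)"
      by blast
    then show "\<exists>r>0. \<forall>y\<in>c ` I. r < y $ k \<longrightarrow> P y"
      using mono pos by (intro exI[of _ "c s $ k"]) auto
  next
    assume "\<exists>r>0. \<forall>y\<in>c ` I. r < y $ k \<longrightarrow> P y"
    then obtain r where r: "r > 0" "\<forall>y\<in>c ` I. r < y $ k \<longrightarrow> P y"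
      by blast
    then obtain s where "s \<in> I" "c s $ k = r"
      using onto by blast
    then show "\<exists>s\<in>I. \<forall>t\<in>I. s < t \<longrightarrow> P (c t)"
      using mono r(2) by (intro bexI[of _ s]) auto
  qed
  then show ?thesis
    by (intro filter_eqI) (unfold eventually_forward_end[OF nonempty] eventually_top_end)
qed

text \<open>Transfers isotropy from a line to every geodesic contained in it, however parametrized. As
  the line is not horizontal, the height serves as a coordinate on it.\<close>

lemma half_space_line_velocity:
  assumes "open I" "c ` I \<subseteq> half_space_line k x V" "V $ k \<noteq> 0" "t \<in> I"
    and U: "(c has_vector_derivative U) (at t)"
  shows "U = (U $ k / V $ k) *\<^sub>R V"
proof -
  have on_line: "c s = x + ((c s $ k - x $ k) / V $ k) *\<^sub>R V" if s: "s \<in> I" for s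
  proof -
    obtain r where "c s = x + r *\<^sub>R V"
      using assms(2) s by blast
    then show ?thesis
      using assms(3) by simp
  qed
  have "((\<lambda>s. c s $ k) has_real_derivative U $ k) (at t)"
    using bounded_linear.has_vector_derivative[OF bounded_linear_vec_nth U]
    by (simp add: has_real_derivative_iff_has_vector_derivative)
  then have "((\<lambda>s. (c s $ k - x $ k) / V $ k) has_real_derivative U $ k / V $ k) (at t)"
    by (auto intro!: derivative_eq_intros simp: assms(3))
  then have "((\<lambda>s. x + ((c s $ k - x $ k) / V $ k) *\<^sub>R V) has_vector_derivative
      0 + (((c t $ k - x $ k) / V $ k) *\<^sub>R 0 + (U $ k / V $ k) *\<^sub>R V)) (at t)"
    by (intro has_vector_derivative_add has_vector_derivative_const has_vector_derivative_scaleR)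
  then have "(c has_vector_derivative
      0 + (((c t $ k - x $ k) / V $ k) *\<^sub>R 0 + (U $ k / V $ k) *\<^sub>R V)) (at t)"
    by (rule has_vector_derivative_transform_within_open[OF _ assms(1,4)]) (rule on_line[symmetric])
  from vector_derivative_unique_at[OF U this] show ?thesis
    by simp
qed

text \<open>The lower bound is the closed one: the point of the line on the boundary of the half-space
  belongs to the set.\<close>

lemma compact_line_slab:
  fixes x V :: "real^'n::finite"
  assumes "V $ k \<noteq> 0"
  shows "compact {y \<in> range (\<lambda>r. x + r *\<^sub>R V). 0 \<le> y $ k \<and> y $ k \<le> B}" (is "compact ?K")
proof -
  have "?K = (\<lambda>u. x + ((u - x $ k) / V $ k) *\<^sub>R V) ` {0..B}"
  proof (intro equalityI subsetI)
    fix y assume "y \<in> ?K"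
    then obtain r where "y = x + r *\<^sub>R V" "y $ k \<in> {0..B}"
      by fastforce
    then show "y \<in> (\<lambda>u. x + ((u - x $ k) / V $ k) *\<^sub>R V) ` {0..B}"
      using assms by (intro image_eqI[of _ _ "y $ k"]) auto
  qed (use assms in auto)
  also have "compact \<dots>"
    using assms by (intro compact_continuous_image continuous_intros) auto
  finally show ?thesis .
qed

text \<open>If the height did not increase, the curve would stay for all later times in the compact part
  of the line between the boundary and the current height.\<close>

lemma escaping_imp_rising:
  assumes "k \<notin> Y" and geo: "geodesic_param (half_space_metric Y k) (half_space k) I c"
    and line: "c ` I \<subseteq> half_space_line k x V" and "V $ k \<noteq> 0"
    and t\<^sub>0: "t\<^sub>0 \<in> I" and U: "(c has_vector_derivative U) (at t\<^sub>0)" "flat_form Y U = 0"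
    and escapes: "escapes_compacts (closed_half_space k) (forward_end I c)"
  shows "U $ k > 0"
proof (rule ccontr)
  assume falling: "\<not> U $ k > 0"
  define h where "h = c t\<^sub>0 $ k"
  have h: "h > 0"
    using geodesic_param_in[OF geo t\<^sub>0] by (simp add: half_space_def h_def)
  let ?K = "{y \<in> range (\<lambda>r. x + r *\<^sub>R V). 0 \<le> y $ k \<and> y $ k \<le> h}"
  have "compact ?K" "?K \<subseteq> closed_half_space k"
    using compact_line_slab[OF assms(4)] by (auto simp: closed_half_space_def)
  then obtain s where s: "s \<in> I" "\<And>t. t \<in> I \<Longrightarrow> s < t \<Longrightarrow> c t \<notin> ?K"
    using escapes t\<^sub>0 unfolding escapes_compacts_def
    by (metis (no_types, lifting) empty_iff eventually_forward_end)
  \<comment> \<open>The interval is open, so it contains a time after both \<open>s\<close> and \<open>t\<^sub>0\<close>.\<close>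
  have "max s t\<^sub>0 \<in> I" "open I"
    using s(1) t\<^sub>0 geo by (simp_all add: max_def geodesic_param_def)
  then obtain e where e: "e > 0" "ball (max s t\<^sub>0) e \<subseteq> I"
    using open_contains_ball by blast
  define t where "t = max s t\<^sub>0 + e / 2"
  have t: "t \<in> I" "s < t" "t\<^sub>0 < t"
    using e by (auto simp: t_def dist_real_def subset_iff)
  have "c t $ k = h\<^sup>2 / (h - (t - t\<^sub>0) * U $ k)"
    using null_geodesic_eq_null_curve(2,3)[OF assms(1) geo t\<^sub>0 U] t(1)
    by (auto simp: null_curve_height h_def)
  also have "\<dots> \<le> h\<^sup>2 / h"
  proof -
    have "(t - t\<^sub>0) * U $ k \<le> 0"
      using t(3) falling by (simp add: mult_nonneg_nonpos)
    then show ?thesis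
      using h by (intro divide_left_mono mult_pos_pos) auto
  qed
  also have "\<dots> = h"
    by (simp add: power2_eq_square)
  finally have "c t \<in> ?K"
    using line t(1) by (auto simp: half_space_def)
  then show False
    using s(2) t by blast
qed


section \<open>Completeness and incompleteness\<close>

lemma null_line_horizontal_iff:
  assumes "x \<in> half_space k"
  shows "(\<exists>h. half_space_line k x V \<subseteq> {y. y $ k = h}) \<longleftrightarrow> V $ k = 0"
proof
  assume "\<exists>h. half_space_line k x V \<subseteq> {y. y $ k = h}"
  then obtain h where h: "half_space_line k x V \<subseteq> {y. y $ k = h}"
    by blast
  show "V $ k = 0"
  proof (rule ccontr)
    assume w: "V $ k \<noteq> 0"
    have "x + r *\<^sub>R V \<in> half_space_line k x V" if "x $ k + r * V $ k > 0" for r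
      using that by (auto simp: half_space_def)
    \<comment> \<open>A second point of the line, at twice the height of \<open>x\<close>.\<close>
    from this[of 0] this[of "x $ k / V $ k"]
    have "x + 0 *\<^sub>R V \<in> half_space_line k x V" "x + (x $ k / V $ k) *\<^sub>R V \<in> half_space_line k x V"
      using assms w by (auto simp: half_space_def)
    then have "(x + 0 *\<^sub>R V) $ k = h" "(x + (x $ k / V $ k) *\<^sub>R V) $ k = h"
      using h by blast+
    then show False
      using assms w by (simp add: half_space_def)
  qed
qed auto

lemma horizontal_null_line_complete:
  assumes "k \<notin> Y" "x \<in> half_space k" "V \<noteq> 0" "flat_form Y V = 0" "V $ k = 0"
  shows "complete_geodesic (half_space_metric Y k) (half_space k) (half_space_line k x V)"
proof -
  have "null_domain k x V 0 = UNIV"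
    using assms(2,5) by (auto simp: null_domain_def half_space_def)
  then show ?thesis
    unfolding complete_geodesic_def
    using maximal_geodesic_param_null_curve[OF assms(1-4), of 0] null_curve_image[OF assms(2), of V 0]
    by metis
qed

text \<open>Escape forces the parametrization to run upwards and hence its forward end to be the top end.
  Conversely, one of the two orientations of the line runs upwards.\<close>

lemma nonhorizontal_null_line_ends:
  fixes x V :: "real^'n::finite" and k :: 'n
  defines "S \<equiv> half_space_line k x V"
  assumes "k \<notin> Y" and x: "x \<in> half_space k" and V: "V \<noteq> 0" "flat_form Y V = 0" and w: "V $ k \<noteq> 0"
  shows "E \<in> geodesic_ends (half_space_metric Y k) (half_space k) S \<and>
      escapes_compacts (closed_half_space k) E \<longleftrightarrow> E = top_end k S"
proof
  assume "E \<in> geodesic_ends (half_space_metric Y k) (half_space k) S \<and>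
      escapes_compacts (closed_half_space k) E"
  then obtain I c where max: "maximal_geodesic_param (half_space_metric Y k) (half_space k) I c"
    and S: "S = c ` I" and E: "E = forward_end I c" "escapes_compacts (closed_half_space k) E"
    by (auto simp: geodesic_ends_def)
  have geo: "geodesic_param (half_space_metric Y k) (half_space k) I c"
    using max by (simp add: maximal_geodesic_param_def)
  obtain t\<^sub>0 where t\<^sub>0: "t\<^sub>0 \<in> I"
    using geodesic_param_nonempty[OF geo] by blast
  obtain U where U: "(c has_vector_derivative U) (at t\<^sub>0)"
    using geodesic_param_velocity[OF geo t\<^sub>0] .
  have line: "c ` I \<subseteq> half_space_line k x V"
    using S by (simp add: S_def)
  have "open I"
    using geo by (simp add: geodesic_param_def)
  from half_space_line_velocity[OF this line w t\<^sub>0 U] have flat: "flat_form Y U = 0"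
    by (metis V(2) flat_form_scaleR mult_zero_right)
  have "U $ k > 0"
    by (rule escaping_imp_rising[OF assms(2) geo line w t\<^sub>0 U flat]) (use E in simp)
  from forward_end_rising_null_geodesic[OF assms(2) max t\<^sub>0 U flat this]
  show "E = top_end k S"
    by (simp add: E S)
next
  assume E: "E = top_end k S"
  define W where "W = sgn (V $ k) *\<^sub>R V"
  have W: "W \<noteq> 0" "flat_form Y W = 0" "W $ k > 0"
    using V w by (auto simp: W_def flat_form_scaleR sgn_if)
  have "half_space_line k x W = S"
  proof -
    have "range (\<lambda>r. x + r *\<^sub>R W) = (\<lambda>r. x + r *\<^sub>R V) ` range (\<lambda>r. r * sgn (V $ k))"
      by (simp add: image_image W_def)
    also have "range (\<lambda>r. r * sgn (V $ k)) = UNIV"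
      using w by (intro surjI[of _ "\<lambda>r. r / sgn (V $ k)"]) (simp add: sgn_if)
    finally show ?thesis
      by (simp add: S_def)
  qed
  then have image: "S = null_curve k x W 0 ` null_domain k x W 0"
    by (simp add: null_curve_image[OF x])
  note max = maximal_geodesic_param_null_curve[OF assms(2) x W(1,2), of 0]
  have "forward_end (null_domain k x W 0) (null_curve k x W 0) = E"
    unfolding E image
    by (rule forward_end_rising_null_geodesic[OF assms(2) max start_in_null_domain[OF x]
          null_curve_start_velocity[OF x] W(2,3)])
  then show "E \<in> geodesic_ends (half_space_metric Y k) (half_space k) S \<and>
      escapes_compacts (closed_half_space k) E"
    using max image top_end_escapes_compacts[of "closed_half_space k" k S]
    unfolding geodesic_ends_def E by (auto intro!: exI)
qed

text \<open>An escaping geodesic rises, so the pole of its height at the finite time \<open>a + z(a) / U\<^sub>k\<close>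
  would have to lie in its interval of definition if that contained \<open>[a, \<infinity>)\<close>.\<close>

lemma nonhorizontal_null_line_incomplete:
  fixes x V :: "real^'n::finite" and k :: 'n
  assumes "k \<notin> Y" and V: "flat_form Y V = 0" and w: "V $ k \<noteq> 0"
    and escapes: "escapes_compacts (closed_half_space k) E"
  shows "\<not> complete_at_end (half_space_metric Y k) (half_space k) (half_space_line k x V) E"
proof
  assume "complete_at_end (half_space_metric Y k) (half_space k) (half_space_line k x V) E"
  then obtain J c a where geo: "geodesic_param (half_space_metric Y k) (half_space k) J c"
    and a: "{a..} \<subseteq> J" and line: "c ` J \<subseteq> half_space_line k x V" and E: "forward_end J c = E"
    unfolding complete_at_end_def by blast
  have aJ: "a \<in> J"
    using a by auto
  obtain U where U: "(c has_vector_derivative U) (at a)"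
    using geodesic_param_velocity[OF geo aJ] .
  have "open J"
    using geo by (simp add: geodesic_param_def)
  from half_space_line_velocity[OF this line w aJ U] have flat: "flat_form Y U = 0"
    by (metis V flat_form_scaleR mult_zero_right)
  have rising: "U $ k > 0"
    by (rule escaping_imp_rising[OF assms(1) geo line w aJ U flat]) (use E escapes in simp)
  have "c a $ k > 0"
    using line aJ by (auto simp: half_space_def)
  then have "a + c a $ k / U $ k \<in> J"
    using a rising by auto
  then have "a + c a $ k / U $ k \<in> null_domain k (c a) U a"
    using null_geodesic_eq_null_curve(2)[OF assms(1) geo aJ U flat] by blast
  then show False
    using rising by (simp add: null_domain_def)
qed


section \<open>The classification theorem\<close>

lemma lightlike_direction_iff_flat_form:
  fixes X Y :: "'n::finite set"
  assumes "X \<union> Y \<union> {k} = UNIV" "X \<inter> Y = {}" "k \<notin> X" "k \<notin> Y"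
  shows "lightlike_direction X Y k d \<longleftrightarrow> d \<noteq> 0 \<and> flat_form Y d = 0"
proof -
  have "flat_form Y d = (\<Sum>i\<in>X. coord_sign Y i * (d $ i)\<^sup>2)
      + (\<Sum>i\<in>Y. coord_sign Y i * (d $ i)\<^sup>2) + coord_sign Y k * (d $ k)\<^sup>2"
    unfolding flat_form_def assms(1)[symmetric] using assms(2-4)
    by (subst sum.union_disjoint; simp)+
  also have "(\<Sum>i\<in>X. coord_sign Y i * (d $ i)\<^sup>2) = (\<Sum>i\<in>X. (d $ i)\<^sup>2)"
    using assms(2) by (intro sum.cong) (auto simp: coord_sign_def)
  also have "(\<Sum>i\<in>Y. coord_sign Y i * (d $ i)\<^sup>2) = - (\<Sum>i\<in>Y. (d $ i)\<^sup>2)"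
    by (simp add: coord_sign_def sum_negf)
  finally show ?thesis
    using assms(4) by (simp add: lightlike_direction_def L2_set_def sum_nonneg coord_sign_def)
qed

theorem proposition4p1:
  fixes p q :: nat and X Y :: "'n::finite set" and k :: 'n
  assumes "p \<ge> 1" and "q \<ge> 0"
    and "X \<union> Y \<union> {k} = UNIV" and "X \<inter> Y = {}" and "k \<notin> X" and "k \<notin> Y"
    and "card X = p - 1" and "card Y = q"
  shows "{S. lightlike_geodesic (half_space_metric Y k) (half_space k) S} =
           {S. S \<noteq> {} \<and> (\<exists>b d. lightlike_direction X Y k d \<and>
                 S = range (\<lambda>t::real. b + t *\<^sub>R d) \<inter> half_space k)} \<and>
         (\<forall>S. lightlike_geodesic (half_space_metric Y k) (half_space k) S \<longrightarrow>
           (if \<exists>h. S \<subseteq> {x. x $ k = h}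
            then complete_geodesic (half_space_metric Y k) (half_space k) S
            else (\<exists>!E. E \<in> geodesic_ends (half_space_metric Y k) (half_space k) S \<and>
                     escapes_compacts (closed_half_space k) E) \<and>
                 (\<forall>E \<in> geodesic_ends (half_space_metric Y k) (half_space k) S.
                     escapes_compacts (closed_half_space k) E \<longrightarrow>
                     \<not> complete_at_end (half_space_metric Y k) (half_space k) S E)))"
proof (intro conjI allI impI)
  note lightlike_iff = lightlike_geodesic_half_space_iff[OF \<open>k \<notin> Y\<close>]
  note direction_iff = lightlike_direction_iff_flat_form[OF assms(3-6)]
  \<comment> \<open>The base point of a line may lie outside the half-space, so it is moved to a point inside.\<close>
  have rebase: "half_space_line k b d = half_space_line k x d" if on_line: "x \<in> half_space_line k b d" for b d x
  proof -
    obtain s where x: "x = b + s *\<^sub>R d"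
      using on_line by blast
    have "range (\<lambda>r. b + r *\<^sub>R d) = range (\<lambda>r. x + r *\<^sub>R d)"
    proof (intro equalityI image_subsetI)
      fix r
      show "b + r *\<^sub>R d \<in> range (\<lambda>r. x + r *\<^sub>R d)"
        by (rule range_eqI[of _ _ "r - s"]) (simp add: x algebra_simps)
      show "x + r *\<^sub>R d \<in> range (\<lambda>r. b + r *\<^sub>R d)"
        by (rule range_eqI[of _ _ "s + r"]) (simp add: x algebra_simps)
    qed
    then show ?thesis
      by simp
  qed
  show "{S. lightlike_geodesic (half_space_metric Y k) (half_space k) S} =
      {S. S \<noteq> {} \<and> (\<exists>b d. lightlike_direction X Y k d \<and> S = half_space_line k b d)}"
  proof (intro set_eqI iffI; unfold mem_Collect_eq)
    fix S assume "lightlike_geodesic (half_space_metric Y k) (half_space k) S"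
    then obtain x V where xV: "x \<in> half_space k" "V \<noteq> 0" "flat_form Y V = 0" "S = half_space_line k x V"
      unfolding lightlike_iff by blast
    then have "x \<in> S"
      by (auto intro: range_eqI[of _ _ 0])
    then show "S \<noteq> {} \<and> (\<exists>b d. lightlike_direction X Y k d \<and> S = half_space_line k b d)"
      using xV direction_iff by blast
  next
    fix S assume "S \<noteq> {} \<and> (\<exists>b d. lightlike_direction X Y k d \<and> S = half_space_line k b d)"
    then obtain x b d where S: "x \<in> S" "d \<noteq> 0" "flat_form Y d = 0" "S = half_space_line k b d"
      using direction_iff by blast
    then show "lightlike_geodesic (half_space_metric Y k) (half_space k) S"
      unfolding lightlike_iff using rebase by (metis IntE)
  qed
  fix S assume "lightlike_geodesic (half_space_metric Y k) (half_space k) S"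
  then obtain x V where x: "x \<in> half_space k" and V: "V \<noteq> 0" "flat_form Y V = 0"
    and S: "S = half_space_line k x V"
    unfolding lightlike_iff by blast
  show "if \<exists>h. S \<subseteq> {x. x $ k = h}
      then complete_geodesic (half_space_metric Y k) (half_space k) S
      else (\<exists>!E. E \<in> geodesic_ends (half_space_metric Y k) (half_space k) S \<and>
               escapes_compacts (closed_half_space k) E) \<and>
           (\<forall>E \<in> geodesic_ends (half_space_metric Y k) (half_space k) S.
               escapes_compacts (closed_half_space k) E \<longrightarrow>
               \<not> complete_at_end (half_space_metric Y k) (half_space k) S E)"
    unfolding S null_line_horizontal_iff[OF x]
    using horizontal_null_line_complete[OF \<open>k \<notin> Y\<close> x V] nonhorizontal_null_line_ends[OF \<open>k \<notin> Y\<close> x V]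
      nonhorizontal_null_line_incomplete[OF \<open>k \<notin> Y\<close> V(2)]
    by simp
qed

end
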